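(* If $f:\mathbb{R}^2\to\mathbb{R}_{\mathcal{F}}$ is a $2\pi$-periodic continuous fuzzy valued function, i.e. $f\in C_{2\pi}^{(\mathcal{F})}(\mathbb{R}^2)$, then $f$ is bounded and uniformly continuous on $\mathbb{R}^2$.
   Context: A fuzzy number is a function $\mu:\mathbb{R}\to[0,1]$ that is normal ($\mu(t_0)=1$ for some $t_0$), fuzzy convex ($\mu(\lambda s+(1-\lambda)t)\ge\min\{\mu(s),\mu(t)\}$ for $\lambda\in[0,1]$), upper semicontinuous, and has compact support $\overline{\{t:\mu(t)>0\}}$. $\mathbb{R}_{\mathcal{F}}$ is the set of fuzzy numbers. The $\alpha$-level set is $[\mu]_\alpha=\{t:\mu(t)\ge\alpha\}$ for $0<\alpha\le1$ and $[\mu]_0=\overline{\{t:\mu(t)>0\}}$; it is a compact interval written $[\mu]_\alpha=[\mu_\alpha^-,\mu_\alpha^+]$. The metric on $\mathbb{R}_{\mathcal{F}}$ is $D(\mu,\eta)=\sup_{\alpha\in[0,1]}\max\{|\mu_\alpha^--\eta_\alpha^-|,|\mu_\alpha^+-\eta_\alpha^+|\}$. A function on $\mathbb{R}^2$ is $2\pi$-periodic if $f(u,v)=f(u+2n\pi,v)=f(u,v+2n\pi)$ for all $n\in\mathbb{Z}$ and all $(u,v)$. $C_{2\pi}^{(\mathcal{F})}(\mathbb{R}^2)$ is the set of $2\pi$-periodic functions $f:\mathbb{R}^2\to\mathbb{R}_{\mathcal{F}}$ that are continuous with respect to $D$. Bounded means that there is $M>0$ with $D(f(u,v),\bar 0)\le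 M$ for all $(u,v)\in\mathbb{R}^2$, where $\bar0$ is the fuzzy number with $\bar0(0)=1$ and $\bar0(t)=0$ for $t\ne0$. Uniform continuity is with respect to the Euclidean metric on $\mathbb{R}^2$ and the metric $D$ on $\mathbb{R}_{\mathcal{F}}$. *)

theory Defs
  imports "HOL-Analysis.Analysis"
begin

definition upper_semicontinuous :: "(real \<Rightarrow> real) \<Rightarrow> bool" where
  "upper_semicontinuous m \<longleftrightarrow> (\<forall>t. \<forall>c > m t. \<forall>\<^sub>F s in nhds t. m s < c)"

definition is_fuzzy_number :: "(real \<Rightarrow> real) \<Rightarrow> bool" where
  "is_fuzzy_number m \<longleftrightarrow>
     range m \<subseteq> {0..1} \<and>
     (\<exists>t. m t = 1) \<and>
     (\<forall>s t. \<forall>l\<in>{0..1}. m (l * s + (1 - l) * t) \<ge> min (m s) (m t)) \<and>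
     upper_semicontinuous m \<and>
     compact (closure {t. m t > 0})"

lemma is_fuzzy_number_zero: "is_fuzzy_number (indicator {0})"
proof -
  have eq: "{t::real. indicator {0} t > (0::real)} = {0}"
    by (auto simp: indicator_def)
  have "\<forall>\<^sub>F s in nhds t. indicator {0} s < c"
    if "indicator {0} t < c" for t c :: real
  proof (cases "t = 0")
    case True
    with that have "indicator {0} s < c" for s :: real
      by (auto simp: indicator_def)
    then show ?thesis by simp
  next
    case False
    then have "\<forall>\<^sub>F s in nhds t. s \<noteq> 0"
      by (intro t1_space_nhds)
    then show ?thesis
      by eventually_elim (use that False in \<open>auto simp: indicator_def\<close>)
  qed
  then have "upper_semicontinuous (indicator {0})"
    unfolding upper_semicontinuous_def by blast
  moreover have "indicator {0} (l * s + (1 - l) * t) \<ge> min (indicator {0} s) (indicator {0} t :: real)"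
    for l s t :: real
    by (cases "s = 0 \<and> t = 0") (simp_all add: indicator_def)
  moreover have "indicator {0} (0::real) = (1::real)" "range (indicator {0::real}) \<subseteq> {0..1::real}"
    "compact (closure {0::real})"
    by (auto simp: indicator_def)
  ultimately show ?thesis
    unfolding is_fuzzy_number_def eq by (intro conjI ballI allI exI[of _ 0]) simp_all
qed

typedef fuzzy_number = "{m. is_fuzzy_number m}"
  morphisms membership Abs_fuzzy_number
  using is_fuzzy_number_zero by blast

definition fuzzy_zero :: fuzzy_number where
  "fuzzy_zero = Abs_fuzzy_number (indicator {0})"

lemma membership_fuzzy_zero: "membership fuzzy_zero t = (if t = 0 then 1 else 0)"
  by (simp add: fuzzy_zero_def Abs_fuzzy_number_inverse is_fuzzy_number_zero)

text \<open>The support, i.e. the level at \<open>0\<close>, is the closure of a strict superlevel set; it is not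
  the instance \<open>a = 0\<close> of the formula for positive levels.\<close>

definition level :: "fuzzy_number \<Rightarrow> real \<Rightarrow> real set" where
  "level m a = (if a = 0 then closure {t. membership m t > 0} else {t. membership m t \<ge> a})"

text \<open>\<open>[lower m a, upper m a]\<close> is the level set at \<open>a\<close> for \<open>0 \<le> a \<le> 1\<close>; see
  \<open>level_eq_interval\<close> below.\<close>

definition lower :: "fuzzy_number \<Rightarrow> real \<Rightarrow> real" where
  "lower m a = Inf (level m a)"

definition upper :: "fuzzy_number \<Rightarrow> real \<Rightarrow> real" where
  "upper m a = Sup (level m a)"

lemma fuzzy_number_membership: "is_fuzzy_number (membership m)"
  using membership[of m] by simp

lemma membership_convex:
  assumes "u \<ge> 0" "v \<ge> 0" "u + v = 1"
  shows "membership m (u * s + v * t) \<ge> min (membership m s) (membership m t)"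
proof -
  have "v = 1 - u" "u \<in> {0..1}" using assms by auto
  then show ?thesis
    using fuzzy_number_membership[of m] unfolding is_fuzzy_number_def by blast
qed

lemma level_subset_support:
  assumes "a \<in> {0..1}" shows "level m a \<subseteq> level m 0"
  using assms closure_subset[of "{t. membership m t > 0}"] by (auto simp: level_def)

lemma level_nonempty: assumes "a \<in> {0..1}" shows "level m a \<noteq> {}"
proof -
  obtain t where t: "membership m t = 1"
    using fuzzy_number_membership[of m] unfolding is_fuzzy_number_def by blast
  have "t \<in> level m a"
    using assms t closure_subset[of "{t. membership m t > 0}"] by (auto simp: level_def)
  then show ?thesis by blast
qed

lemma level_compact: assumes "a \<in> {0..1}" shows "compact (level m a)"
proof (cases "a = 0")
  case True
  then show ?thesis
    using fuzzy_number_membership[of m] by (simp add: level_def is_fuzzy_number_def)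
next
  case False
  have "open {t. membership m t < a}"
  proof (subst open_subopen, rule ballI)
    fix t assume "t \<in> {t. membership m t < a}"
    then have "\<forall>\<^sub>F s in nhds t. membership m s < a"
      using fuzzy_number_membership[of m]
      by (simp add: is_fuzzy_number_def upper_semicontinuous_def)
    then show "\<exists>T. open T \<and> t \<in> T \<and> T \<subseteq> {t. membership m t < a}"
      unfolding eventually_nhds by blast
  qed
  moreover have "- {t. membership m t < a} = level m a"
    using False by (auto simp: level_def)
  ultimately have "closed (level m a)"
    by (metis closed_Compl)
  moreover have "compact (level m 0)"
    using fuzzy_number_membership[of m] by (simp add: level_def is_fuzzy_number_def)
  ultimately show ?thesis
    using level_subset_support[OF assms, of m] compact_Int_closed[of "level m 0" "level m a"]
    by (metis inf.absorb2)
qed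

lemma level_convex: "convex (level m a)"
proof (cases "a = 0")
  case True
  have "convex {t. membership m t > 0}"
  proof (rule convexI)
    fix s t u v :: real
    assume "s \<in> {t. membership m t > 0}" "t \<in> {t. membership m t > 0}" "0 \<le> u" "0 \<le> v" "u + v = 1"
    then show "u *\<^sub>R s + v *\<^sub>R t \<in> {t. membership m t > 0}"
      using membership_convex[of u v m s t] by (auto simp: min_def split: if_splits)
  qed
  then show ?thesis using True by (simp add: level_def convex_closure)
next
  case False
  have "convex {t. membership m t \<ge> a}"
  proof (rule convexI)
    fix s t u v :: real
    assume "s \<in> {t. membership m t \<ge> a}" "t \<in> {t. membership m t \<ge> a}" "0 \<le> u" "0 \<le> v" "u + v = 1"
    then show "u *\<^sub>R s + v *\<^sub>R t \<in> {t. membership m t \<ge> a}"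
      using membership_convex[of u v m s t] by (auto simp: min_def split: if_splits)
  qed
  then show ?thesis using False by (simp add: level_def)
qed

lemma level_eq_interval:
  assumes "a \<in> {0..1}"
  shows "level m a = {lower m a..upper m a}"
proof -
  have "compact (level m a)" "connected (level m a)" "level m a \<noteq> {}"
    using assms level_compact level_convex level_nonempty convex_connected by blast+
  moreover from this(1,2) obtain x y where "level m a = {x..y}"
    using connected_compact_interval_1[of "level m a"] by blast
  ultimately have "level m a = {x..y}" "x \<le> y"
    by simp_all
  then show ?thesis by (simp add: lower_def upper_def)
qed

lemma lower_le_upper: assumes "a \<in> {0..1}" shows "lower m a \<le> upper m a"
  using level_eq_interval[OF assms, of m] level_nonempty[OF assms, of m] by simp

lemma level_bounds:
  assumes "a \<in> {0..1}"
  shows "lower m 0 \<le> lower m a" "upper m a \<le> upper m 0"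
proof -
  have "{lower m a..upper m a} \<subseteq> {lower m 0..upper m 0}"
    using level_subset_support[OF assms, of m] level_eq_interval[OF assms, of m]
      level_eq_interval[of 0 m] by simp
  then show "lower m 0 \<le> lower m a" "upper m a \<le> upper m 0"
    using lower_le_upper[OF assms, of m] by auto
qed

lemma fuzzy_number_eqI:
  assumes "\<And>a. a \<in> {0..1} \<Longrightarrow> level m a = level n a"
  shows "m = n"
proof -
  have aux: "membership p t \<le> membership q t"
    if "\<And>a. a \<in> {0..1} \<Longrightarrow> level p a = level q a" for p q t
  proof -
    have r: "membership p t \<in> {0..1}" "membership q t \<in> {0..1}"
      using fuzzy_number_membership[of p] fuzzy_number_membership[of q]
      by (auto simp: is_fuzzy_number_def image_subset_iff)
    show ?thesis
    proof (cases "membership p t = 0")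
      case False
      then have "t \<in> level p (membership p t)" by (simp add: level_def)
      then have "t \<in> level q (membership p t)" using that[OF r(1)] by simp
      then show ?thesis using False by (simp add: level_def)
    qed (use r in auto)
  qed
  have "membership m t = membership n t" for t
    using aux[of m n t] aux[of n m t] assms by force
  then have "membership m = membership n" by (rule ext)
  then show ?thesis by (simp add: membership_inject)
qed

text \<open>The distance below is the supremum metric \<open>D\<close>; the family is bounded above, so the real-valued
  supremum is the intended one. Continuity and uniform continuity of maps into
  \<open>fuzzy_number\<close> are the library notions for this metric.\<close>

instantiation fuzzy_number :: metric_space
begin

definition dist_fuzzy_number :: "fuzzy_number \<Rightarrow> fuzzy_number \<Rightarrow> real" where
  "dist m n = (SUP a\<in>{0..1}. max \<bar>lower m a - lower n a\<bar> \<bar>upper m a - upper n a\<bar>)"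

definition uniformity_fuzzy_number :: "(fuzzy_number \<times> fuzzy_number) filter" where
  "uniformity_fuzzy_number = (INF e\<in>{0 <..}. principal {(x, y). dist x y < e})"

definition open_fuzzy_number :: "fuzzy_number set \<Rightarrow> bool" where
  "open_fuzzy_number U \<longleftrightarrow> (\<forall>x\<in>U. eventually (\<lambda>(x', y). x' = x \<longrightarrow> y \<in> U) uniformity)"

instance
proof
  let ?g = "\<lambda>m n a. max \<bar>lower m a - lower n a\<bar> \<bar>upper m a - upper n a\<bar>"
  have bdd: "bdd_above (?g m n ` {0..1})" for m n :: fuzzy_number
  proof (rule bdd_aboveI2)
    fix a :: real assume a: "a \<in> {0..1}"
    show "?g m n a \<le> \<bar>upper m 0 - lower n 0\<bar> + \<bar>upper n 0 - lower m 0\<bar>"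
      using level_bounds[OF a, of m] level_bounds[OF a, of n]
        lower_le_upper[OF a, of m] lower_le_upper[OF a, of n] by linarith
  qed
  have le: "?g m n a \<le> dist m n" if "a \<in> {0..1}" for m n :: fuzzy_number and a
    unfolding dist_fuzzy_number_def using bdd that by (rule cSUP_upper2) simp
  fix x y z :: fuzzy_number
  show "dist x y = 0 \<longleftrightarrow> x = y"
  proof
    assume d: "dist x y = 0"
    show "x = y"
    proof (rule fuzzy_number_eqI)
      fix a :: real assume a: "a \<in> {0..1}"
      have "?g x y a \<le> 0" using le[OF a, of x y] d by simp
      then have "lower x a = lower y a" "upper x a = upper y a" by auto
      then show "level x a = level y a" using level_eq_interval[OF a] by simp
    qed
  qed (simp add: dist_fuzzy_number_def)
  show "dist x y \<le> dist x z + dist y z"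
    unfolding dist_fuzzy_number_def[of x y]
  proof (rule cSUP_least)
    fix a :: real assume a: "a \<in> {0..1}"
    show "?g x y a \<le> dist x z + dist y z"
      using le[OF a, of x z] le[OF a, of y z] by linarith
  qed simp
qed (simp_all add: uniformity_fuzzy_number_def open_fuzzy_number_def)

end

text \<open>The plane is \<open>real \<times> real\<close>, whose library metric is the Euclidean one.\<close>

definition periodic_2pi :: "(real \<times> real \<Rightarrow> 'a) \<Rightarrow> bool" where
  "periodic_2pi f \<longleftrightarrow>
     (\<forall>u v. \<forall>n::int. f (u + 2 * of_int n * pi, v) = f (u, v) \<and>
                      f (u, v + 2 * of_int n * pi) = f (u, v))"

definition C_2pi_fuzzy :: "(real \<times> real \<Rightarrow> fuzzy_number) set" where
  "C_2pi_fuzzy = {f. periodic_2pi f \<and> continuous_on UNIV f}"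

definition fuzzy_bounded :: "(real \<times> real \<Rightarrow> fuzzy_number) \<Rightarrow> bool" where
  "fuzzy_bounded f \<longleftrightarrow> (\<exists>M>0. \<forall>u v. dist (f (u, v)) fuzzy_zero \<le> M)"

end

theory Submission
  imports Defs
begin

text \<open>Every pair of points at distance less than 1 can be moved simultaneously, by one common period
  of the function, into the compact square of points with both coordinates in \<open>[-1, 2\<pi> + 1]\<close>.
  The margin 1 around a period cell keeps the two points together, so boundedness and
  uniform continuity (Heine--Cantor) transfer from the square to the plane.\<close>

lemma periodic_2pi_shift_into_cell:
  fixes p :: "real \<times> real"
  assumes "periodic_2pi f"
  obtains c where "p + c \<in> {0..2 * pi} \<times> {0..2 * pi}" "\<And>q. f (q + c) = f q"
proof -
  \<comment> \<open>Minus the number of whole periods below \<open>x\<close>: adding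
    \<open>k x\<close> periods leaves the remainder of \<open>x\<close> modulo 2\<pi>, which is
    2\<pi> times the fractional part of \<open>x / (2 * pi)\<close>.\<close>
  define k :: "real \<Rightarrow> int" where "k x = - \<lfloor>x / (2 * pi)\<rfloor>" for x
  have cell: "x + 2 * of_int (k x) * pi \<in> {0..2 * pi}" for x
  proof -
    have "x + 2 * of_int (k x) * pi = 2 * pi * frac (x / (2 * pi))"
      by (simp add: k_def frac_def algebra_simps)
    moreover have "2 * pi * frac (x / (2 * pi)) \<le> 2 * pi * 1"
      by (intro mult_left_mono) (simp_all add: frac_lt_1 less_imp_le)
    ultimately show ?thesis by simp
  qed
  let ?c = "(2 * of_int (k (fst p)) * pi, 2 * of_int (k (snd p)) * pi)"
  have "p + ?c \<in> {0..2 * pi} \<times> {0..2 * pi}"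
    using cell[of "fst p"] cell[of "snd p"] by (cases p) simp
  moreover have "f (q + ?c) = f q" for q
    using assms by (cases q) (simp add: periodic_2pi_def)
  ultimately show thesis by (rule that)
qed

text \<open>Points are moved one at a time here, so the closed period cell suffices: every value of
  \<open>f\<close> is attained on it, and its continuous image is compact.\<close>

lemma periodic_2pi_bounded_range:
  fixes f :: "real \<times> real \<Rightarrow> 'a::metric_space"
  assumes "periodic_2pi f" "continuous_on UNIV f"
  shows "bounded (range f)"
proof -
  let ?K = "{0..2 * pi} \<times> {0..2 * pi}"
  have "range f \<subseteq> f ` ?K"
  proof (rule image_subsetI)
    fix p
    obtain c where "p + c \<in> ?K" "f (p + c) = f p"
      using periodic_2pi_shift_into_cell[OF assms(1)] by metis
    then show "f p \<in> f ` ?K" by (metis imageI)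
  qed
  moreover have "compact (f ` ?K)"
    using assms(2) by (intro compact_continuous_image compact_Times)
      (auto intro: continuous_on_subset)
  ultimately show ?thesis
    using bounded_subset compact_imp_bounded by blast
qed

lemma periodic_2pi_uniformly_continuous:
  fixes f :: "real \<times> real \<Rightarrow> 'a::metric_space"
  assumes "periodic_2pi f" "continuous_on UNIV f"
  shows "uniformly_continuous_on UNIV f"
  unfolding uniformly_continuous_on_def
proof (intro allI impI)
  fix e :: real assume "e > 0"
  let ?K = "{-1..2 * pi + 1} \<times> {-1..2 * pi + 1}"
  have "uniformly_continuous_on ?K f"
    using assms(2) by (intro compact_uniformly_continuous compact_Times)
      (auto intro: continuous_on_subset)
  with \<open>e > 0\<close> obtain d where "d > 0"
    and d: "\<And>p q. p \<in> ?K \<Longrightarrow> q \<in> ?K \<Longrightarrow> dist q p < d \<Longrightarrow> dist (f q) (f p) < e"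
    unfolding uniformly_continuous_on_def by blast
  \<comment> \<open>The bound \<open>d\<close> is the modulus on \<open>?K\<close>; the bound 1 is
    the margin of \<open>?K\<close>, so that \<open>q + c\<close> stays in \<open>?K\<close> once
    \<open>p + c\<close> lies in the period cell.\<close>
  have "dist (f q) (f p) < e" if close: "dist q p < min d 1" for p q
  proof -
    obtain c where c: "p + c \<in> {0..2 * pi} \<times> {0..2 * pi}" and f: "\<And>q. f (q + c) = f q"
      using periodic_2pi_shift_into_cell[OF assms(1)] by metis
    have near: "dist (q + c) (p + c) < min d 1" using close by simp
    \<comment> \<open>Coordinate projections do not increase the Euclidean distance, and the common
      shift by \<open>c\<close> preserves it.\<close>
    have "\<bar>fst (q + c) - fst (p + c)\<bar> < 1" "\<bar>snd (q + c) - snd (p + c)\<bar> < 1"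
      using near dist_fst_le[of "q + c" "p + c"] dist_snd_le[of "q + c" "p + c"]
      unfolding dist_real_def by linarith+
    then have "q + c \<in> ?K" "p + c \<in> ?K" using c by (auto simp: mem_Times_iff)
    then have "dist (f (q + c)) (f (p + c)) < e" using d near by simp
    then show ?thesis by (simp only: f)
  qed
  then show "\<exists>d>0. \<forall>p\<in>UNIV. \<forall>q\<in>UNIV. dist q p < d \<longrightarrow> dist (f q) (f p) < e"
    using \<open>d > 0\<close> by (intro exI[of _ "min d 1"]) simp
qed

theorem theorem1p2:
  fixes f :: "real \<times> real \<Rightarrow> fuzzy_number"
  assumes "f \<in> C_2pi_fuzzy"
  shows "fuzzy_bounded f \<and> uniformly_continuous_on UNIV f"
proof
  have per: "periodic_2pi f" and cont: "continuous_on UNIV f"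
    using assms by (auto simp: C_2pi_fuzzy_def)
  obtain M where M: "\<And>p. dist fuzzy_zero (f p) \<le> M"
    using periodic_2pi_bounded_range[OF per cont] by (auto simp: bounded_any_center[of _ fuzzy_zero])
  \<comment> \<open>\<open>fuzzy_bounded\<close> asks for a strictly positive bound, whereas
    \<open>M\<close> may be 0 if \<open>f\<close> is constantly \<open>fuzzy_zero\<close>.\<close>
  have "dist (f (u, v)) fuzzy_zero \<le> max M 1" for u v
    using M[of "(u, v)"] by (simp add: dist_commute)
  then show "fuzzy_bounded f"
    unfolding fuzzy_bounded_def by (intro exI[of _ "max M 1"]) simp
  show "uniformly_continuous_on UNIV f"
    using periodic_2pi_uniformly_continuous[OF per cont] .
qed

end
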